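(* Let $X=[x_1,\dots,x_n]$ be a finite set of vectors in $\mathbb{R}^m$ having an MSS $\{X_1,\dots,X_K\}$ (without pure segment), and put $\mathcal S_k=\mathrm{span}(X_k)$, $d_k=r(X_k)$, $n_k=n(X_k)$, $d=\sum_k d_k$. Assume that (i) $x_j\notin\mathcal S_k\cap\mathcal S_\ell$ for all $j\le n$ and $k\neq\ell$, (ii) $\{X_1,\dots,X_K\}$ is intersected nondegenerately, and $$d_{\rm int}<d_{\min},\qquad d_0\le d_{\min},\qquad n_k>d_k+(K-1)d_0\ \text{ for all } k.$$ If $C$ is a block-diagonal representation matrix of $X$ (up to a simultaneous permutation of rows and columns) with $\mathrm{rank}(C)=d$ and with $K$ diagonal blocks, each of size greater than $d_{\min}$, then $C$ is a minimal subspace detectable representation (MSDR) of $X$. Furthermore, such a $C$ is unique if it is restricted to be symmetric.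
   Context: A real matrix $X=[x_1,\dots,x_n]$ is identified with the (indexed) finite set of its columns; a subset is a column submatrix. $r(X')$ and $n(X')$ denote rank and number of columns, $\mathrm{span}(X')$ the column space. $X\setminus X'$ denotes the remaining columns. A set $X'$ is nondegenerate if every subset with rank smaller than $r(X')$ is of full column rank. $\mathrm{span}(X')$ (with its spanning set $X'$) is minimal if $n(X')>r(X')$ and $X'$ is nondegenerate. An MSS of $X$ without pure segment is a partition of the columns of $X$ into nonempty segments $X_1,\dots,X_K$ such that each $\mathrm{span}(X_k)$ is minimal and $\mathrm{span}(X_k)\ne\mathrm{span}(X_\ell)$ for $k\neq\ell$. $\{X_k\}$ is intersected nondegenerately if for every $k$ and every subset $X_k'$ of $X\setminus X_k$: with $\mathcal S_k'=\mathrm{span}(X_k)\cap\mathrm{span}(X_k')$ and $\mathcal S_k''$ the orthogonal complement of $\mathcal S_k'$ within $\mathrm{span}(X_k)$, in the columnwise splitting $X_k=Y_k+Z_k$ with columns of $Y_k$ in $\mathcal S_k'$ and of $Z_k$ in $\mathcal S_k''$, $Z_k$ is zero or nondegenerate. Notation: $d_{\min}=\min_k d_k$, $d_0=\max_k\dim\big(\mathcal S_k\cap\sum_{j\ne k}\mathcal S_j\big)$, $d_{\rm int}=\max_{k\neq j}\dim(\mathcal S_k\cap\mathcal S_j)$. A representation matrix of $X$ is a matrix $C\in\mathbb{R}^{n\times n}$ with $X=XC$. A square matrix $A$ is connected if the undirected graph on its index set with an edge between $i$ and $j$ whenever the $(i,j)$ entry of $|A|+|A|^T$ is nonzero is connected.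 A representation matrix $C$ of $X$ is minimal subspace detectable (an MSDR) if there is a permutation matrix $\Pi$ such that $X\Pi=[X_1,\dots,X_K]$ and $C=\Pi\,\mathrm{diag}(C_1,\dots,C_K)\,\Pi^T$, where $\{X_k\}$ is an MSS of $X$ and each $C_k$ is connected. *)

theory Defs
  imports "HOL-Analysis.Analysis"
begin

text \<open>
  A column submatrix of a matrix with column index type \<open>'n\<close> is represented by the set of its
  column indices, so that repeated columns are counted with multiplicity.
\<close>

definition col_span :: "real^'n^'m \<Rightarrow> 'n set \<Rightarrow> (real^'m) set" where
  "col_span A I = span ((\<lambda>j. column j A) ` I)"

definition col_rank :: "real^'n^'m \<Rightarrow> 'n set \<Rightarrow> nat" where
  "col_rank A I = dim (col_span A I)"

definition nondegenerate :: "real^'n^'m \<Rightarrow> 'n::finite set \<Rightarrow> bool" where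
  "nondegenerate A I \<longleftrightarrow>
     (\<forall>J\<subseteq>I. col_rank A J < col_rank A I \<longrightarrow> col_rank A J = card J)"

definition minimal_span :: "real^'n^'m \<Rightarrow> 'n::finite set \<Rightarrow> bool" where
  "minimal_span A I \<longleftrightarrow> card I > col_rank A I \<and> nondegenerate A I"

text \<open>The segments are \<open>I 0, \<dots>, I (K - 1)\<close>.\<close>

definition is_MSS :: "real^'n^'m \<Rightarrow> nat \<Rightarrow> (nat \<Rightarrow> 'n::finite set) \<Rightarrow> bool" where
  "is_MSS X K I \<longleftrightarrow>
     (\<Union>k<K. I k) = UNIV \<and> disjoint_family_on I {..<K} \<and> (\<forall>k<K. I k \<noteq> {}) \<and>
     (\<forall>k<K. minimal_span X (I k)) \<and>
     (\<forall>k<K. \<forall>l<K. k \<noteq> l \<longrightarrow> col_span X (I k) \<noteq> col_span X (I l))"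

text \<open>
  Only the columns of \<open>Y\<close> and \<open>Z\<close> with index in \<open>I k\<close> matter below; these are uniquely determined
  by the splitting.
\<close>

definition intersected_nondegenerately ::
  "real^'n^'m \<Rightarrow> nat \<Rightarrow> (nat \<Rightarrow> 'n::finite set) \<Rightarrow> bool" where
  "intersected_nondegenerately X K I \<longleftrightarrow>
     (\<forall>k<K. \<forall>J \<subseteq> UNIV - I k.
        let S' = col_span X (I k) \<inter> col_span X J;
            S'' = col_span X (I k) \<inter> orthogonal_comp S'
        in \<forall>Y Z :: real^'n^'m.
             (\<forall>j\<in>I k. column j X = column j Y + column j Z \<and>
                       column j Y \<in> S' \<and> column j Z \<in> S'')
             \<longrightarrow> (\<forall>j\<in>I k. column j Z = 0) \<or> nondegenerate Z (I k))"

definition d_min :: "real^'n^'m \<Rightarrow> nat \<Rightarrow> (nat \<Rightarrow> 'n set) \<Rightarrow> nat" where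
  "d_min X K I = Min ((\<lambda>k. col_rank X (I k)) ` {..<K})"

text \<open>The sum of the subspaces is the elementwise sum of sets; the empty sum is \<open>{0}\<close>.\<close>

definition d_0 :: "real^'n^'m \<Rightarrow> nat \<Rightarrow> (nat \<Rightarrow> 'n set) \<Rightarrow> nat" where
  "d_0 X K I =
     Max ((\<lambda>k. dim (col_span X (I k) \<inter> (\<Sum>j\<in>{..<K} - {k}. col_span X (I j)))) ` {..<K})"

text \<open>For \<open>K = 1\<close> there are no pairs, and the maximum is taken to be \<open>0\<close>.\<close>

definition d_int :: "real^'n^'m \<Rightarrow> nat \<Rightarrow> (nat \<Rightarrow> 'n set) \<Rightarrow> nat" where
  "d_int X K I =
     Max (insert 0 {dim (col_span X (I k) \<inter> col_span X (I j)) | k j. k < K \<and> j < K \<and> k \<noteq> j})"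

definition is_representation :: "real^'n^'m \<Rightarrow> real^'n^'n \<Rightarrow> bool" where
  "is_representation X C \<longleftrightarrow> X = X ** C"

text \<open>
  Column \<open>j\<close> of \<open>X ** perm_matrix p\<close> is column \<open>p j\<close> of \<open>X\<close>.
\<close>

definition perm_matrix :: "('n \<Rightarrow> 'n) \<Rightarrow> real^'n^'n" where
  "perm_matrix p = (\<chi> i j. if i = p j then 1 else 0)"

text \<open>
  \<open>D = diag(D\<^sub>0, \<dots>, D\<^sub>K\<^sub>-\<^sub>1)\<close> with square nonempty blocks: \<open>b i\<close> is the number of the block
  containing the index \<open>i\<close>, and monotonicity says that the blocks are consecutive intervals
  of indices.
\<close>

definition block_diagonal ::
  "nat \<Rightarrow> ('n \<Rightarrow> nat) \<Rightarrow> real^('n::{finite,linorder})^('n::{finite,linorder}) \<Rightarrow> bool" where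
  "block_diagonal K b D \<longleftrightarrow>
     mono b \<and> range b = {..<K} \<and> (\<forall>i j. b i \<noteq> b j \<longrightarrow> D $ i $ j = 0)"

text \<open>Connectedness of the principal submatrix of \<open>A\<close> with index set \<open>I\<close>.\<close>

definition connected_matrix :: "real^'n^'n \<Rightarrow> 'n set \<Rightarrow> bool" where
  "connected_matrix A I \<longleftrightarrow>
     (\<forall>i\<in>I. \<forall>j\<in>I.
        (i, j) \<in> {(u, v). u \<in> I \<and> v \<in> I \<and> \<bar>A $ u $ v\<bar> + \<bar>A $ v $ u\<bar> \<noteq> 0}\<^sup>*)"

definition is_MSDR :: "real^('n::{finite,linorder})^'m \<Rightarrow> real^('n::{finite,linorder})^('n::{finite,linorder}) \<Rightarrow> bool" where
  "is_MSDR X C \<longleftrightarrow>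
     is_representation X C \<and>
     (\<exists>p K b D. p permutes UNIV \<and> block_diagonal K b D \<and>
        C = perm_matrix p ** D ** transpose (perm_matrix p) \<and>
        is_MSS X K (\<lambda>k. p ` {j. b j = k}) \<and>
        (\<forall>k<K. connected_matrix D {j. b j = k}))"

definition block_diagonal_up_to_perm ::
  "nat \<Rightarrow> nat \<Rightarrow> real^('n::{finite,linorder})^('n::{finite,linorder}) \<Rightarrow> bool" where
  "block_diagonal_up_to_perm K s C \<longleftrightarrow>
     (\<exists>p b D. p permutes UNIV \<and> block_diagonal K b D \<and>
        C = perm_matrix p ** D ** transpose (perm_matrix p) \<and>
        (\<forall>k<K. card {j. b j = k} > s))"

end

theory Submission
  imports Defs
begin

text \<open>
  Write \<open>r\<close> for the column rank and \<open>m\<close> for \<open>d_min\<close>. Nondegenerate intersection says that for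
  \<open>A \<subseteq> I k\<close> and \<open>J\<close> disjoint from \<open>I k\<close> either \<open>A\<close> is independent modulo \<open>J\<close>, or \<open>J \<union> A\<close> spans the
  whole segment \<open>I k\<close>. Let \<open>B l\<close> be the index sets of the \<open>K\<close> diagonal blocks of \<open>C\<close>; then the ranks
  \<open>r (B l)\<close> add up to at most \<open>d\<close>. Say that \<open>B l\<close> saturates \<open>k\<close> if its columns from \<open>I k\<close> are dependent
  modulo the other ones. If no block saturated \<open>k\<close>, the sum of the ranks would be at least
  \<open>card (I k)\<close> plus the rank of the remaining segments, which exceeds \<open>d\<close>. On the other hand
  \<open>r (B l) - m\<close> is at least the sum of \<open>r (I k) - m\<close> over the saturated \<open>k\<close>, strictly unless exactly
  one \<open>k\<close> is saturated. Summing over \<open>l\<close> shows that saturation is a bijection, and comparing ranks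
  shows that the blocks are the segments.

  A disconnected block would split a segment into two parts whose ranks add up to at most the rank of
  the segment, against nondegeneracy. The symmetric solution is unique because \<open>X\<close> is injective on the
  column space of each block, so that \<open>C ** C' = C\<close> for any two solutions.
\<close>

section \<open>Dimension calculus for sets of columns\<close>

lemma dim_Un_Int_span:
  fixes S T :: "'a::euclidean_space set"
  shows "dim (S \<union> T) + dim (span S \<inter> span T) = dim S + dim T"
proof -
  have "dim (S \<union> T) = dim {x + y | x y. x \<in> span S \<and> y \<in> span T}"
    by (metis (no_types) dim_span span_Un)
  then show ?thesis
    using dim_sums_Int[of "span S" "span T"] by simp
qed

lemma col_rank_eq_dim: "col_rank A I = dim ((\<lambda>j. column j A) ` I)"
  by (simp add: col_rank_def col_span_def)

lemma col_rank_empty [simp]: "col_rank A {} = 0"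
  by (simp add: col_rank_eq_dim)

lemma col_span_mono: "I \<subseteq> J \<Longrightarrow> col_span A I \<subseteq> col_span A J"
  unfolding col_span_def by (intro span_mono image_mono)

lemma column_in_col_span: "j \<in> I \<Longrightarrow> column j A \<in> col_span A I"
  unfolding col_span_def by (intro span_base imageI)

lemma col_rank_mono: "I \<subseteq> J \<Longrightarrow> col_rank A I \<le> col_rank A J"
  unfolding col_rank_eq_dim by (intro dim_subset image_mono)

lemma col_rank_mono_span: "col_span A I \<subseteq> col_span A J \<Longrightarrow> col_rank A I \<le> col_rank A J"
  unfolding col_rank_def by (rule dim_subset)

lemma col_span_eqI:
  "col_span A I \<subseteq> col_span A J \<Longrightarrow> col_rank A J \<le> col_rank A I \<Longrightarrow> col_span A I = col_span A J"
  unfolding col_rank_def col_span_def by (intro subspace_dim_equal) auto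

lemma col_rank_le_card: "finite I \<Longrightarrow> col_rank A I \<le> card I"
  unfolding col_rank_eq_dim
  by (meson card_image_le dim_le_card' finite_imageI order_trans)

lemma col_rank_Un:
  "col_rank A (I \<union> J) + dim (col_span A I \<inter> col_span A J) = col_rank A I + col_rank A J"
  using dim_Un_Int_span[of "(\<lambda>j. column j A) ` I" "(\<lambda>j. column j A) ` J"]
  by (simp add: col_rank_eq_dim col_span_def image_Un)

lemma col_rank_submodular:
  "col_rank A (I \<union> J) + col_rank A (I \<inter> J) \<le> col_rank A I + col_rank A J"
proof -
  have "col_span A (I \<inter> J) \<subseteq> col_span A I \<inter> col_span A J"
    by (simp add: col_span_mono)
  then have "col_rank A (I \<inter> J) \<le> dim (col_span A I \<inter> col_span A J)"
    unfolding col_rank_def by (rule dim_subset)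
  then show ?thesis
    using col_rank_Un[of A I J] by linarith
qed

lemma col_rank_UN_le:
  "finite T \<Longrightarrow> col_rank A (\<Union>l\<in>T. B l) \<le> (\<Sum>l\<in>T. col_rank A (B l))"
proof (induction T rule: finite_induct)
  case (insert l T)
  then show ?case
    using col_rank_submodular[of A "B l" "\<Union>l\<in>T. B l"] by simp
qed simp

lemma sum_col_span:
  assumes "finite T"
  shows "(\<Sum>j\<in>T. col_span X (I j)) = col_span X (\<Union>j\<in>T. I j)"
  using assms
proof (induction T rule: finite_induct)
  case empty
  then show ?case by (simp add: col_span_def)
next
  case (insert j T)
  have "col_span X (I j \<union> J) = col_span X (I j) + col_span X J" for J
    unfolding col_span_def image_Un span_Un set_plus_def by blast
  with insert show ?case by simp
qed

section \<open>Rank consequences of nondegeneracy\<close>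

lemma nondegenerate_rank:
  assumes "nondegenerate Z S" and "A \<subseteq> S"
  shows "col_rank Z A = card A \<or> col_rank Z A = col_rank Z S"
proof -
  have "col_rank Z A \<le> col_rank Z S" using assms(2) by (rule col_rank_mono)
  then show ?thesis
    using assms unfolding nondegenerate_def by (meson le_neq_implies_less)
qed

text \<open>Modulo \<open>span J\<close>, the columns of the segment \<open>I k\<close> are those of \<open>Z\<close> in the definition of
  nondegenerate intersection.\<close>

lemma intersected_nondegenerately_rank:
  fixes X :: "real^'n::finite^'m"
  assumes "intersected_nondegenerately X K I" and "k < K" and "A \<subseteq> I k" and "J \<inter> I k = {}"
  shows "col_rank X (J \<union> A) = col_rank X J + card A \<or> col_span X (I k) \<subseteq> col_span X (J \<union> A)"
proof -
  define S' where "S' = col_span X (I k) \<inter> col_span X J"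
  define S'' where "S'' = col_span X (I k) \<inter> orthogonal_comp S'"
  have sub: "subspace S'" "subspace S''"
    unfolding S'_def S''_def col_span_def
    by (auto intro!: subspace_inter subspace_orthogonal_comp)
  have "\<exists>y. y \<in> S' \<and> column j X - y \<in> S''" if "j \<in> I k" for j
  proof -
    obtain y z where yz: "y \<in> span S'" "\<And>w. w \<in> span S' \<Longrightarrow> orthogonal z w" "column j X = y + z"
      using orthogonal_subspace_decomp_exists by blast
    have y: "y \<in> S'" using yz(1) sub(1) by (simp add: span_eq_iff[THEN iffD2])
    have "z \<in> orthogonal_comp S'"
      using yz(2) by (auto simp: orthogonal_comp_def orthogonal_commute span_base)
    moreover have "column j X - y \<in> col_span X (I k)"
      using y that unfolding S'_def col_span_def by (intro span_diff) (auto simp: span_base)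
    ultimately show ?thesis using y yz(3) by (auto simp: S''_def)
  qed
  then obtain y where y: "\<And>j. j \<in> I k \<Longrightarrow> y j \<in> S'" "\<And>j. j \<in> I k \<Longrightarrow> column j X - y j \<in> S''"
    by metis
  define Y :: "real^'n^'m" where "Y = (\<chi> i j. y j $ i)"
  define Z :: "real^'n^'m" where "Z = (\<chi> i j. (column j X - y j) $ i)"
  have colY: "column j Y = y j" and colZ: "column j Z = column j X - y j" for j
    by (simp_all add: Y_def Z_def column_def vec_eq_iff)
  have nd: "(\<forall>j\<in>I k. column j Z = 0) \<or> nondegenerate Z (I k)"
  proof -
    have "J \<subseteq> UNIV - I k" using assms(4) by blast
    moreover have "\<forall>j\<in>I k. column j X = column j Y + column j Z \<and> column j Y \<in> S' \<and> column j Z \<in> S''"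
      using y by (simp add: colY colZ)
    ultimately show ?thesis
      using assms(1,2) unfolding intersected_nondegenerately_def Let_def S'_def S''_def by blast
  qed
  \<comment> \<open>Replacing column \<open>j\<close> of \<open>X\<close> by that of
    \<open>Z\<close> subtracts \<open>y j\<close>, which lies in the span of \<open>J\<close>, so
    the span together with \<open>J\<close> stays the same. The columns of \<open>Z\<close> lie in
    \<open>S''\<close>, and a vector of \<open>S''\<close> in the span of \<open>J\<close> lies in
    \<open>S'\<close> and is orthogonal to itself.\<close>
  have rank: "col_rank X (J \<union> B) = col_rank X J + col_rank Z B" if "B \<subseteq> I k" for B
  proof -
    let ?x = "(\<lambda>j. column j X) ` J" and ?z = "(\<lambda>j. column j Z) ` B"
    have yJ: "y j \<in> span ?x" if "j \<in> B" for j
      using y(1) that \<open>B \<subseteq> I k\<close> unfolding S'_def col_span_def by blast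
    have "span (?x \<union> (\<lambda>j. column j X) ` B) = span (?x \<union> ?z)"
    proof (rule span_eq[THEN iffD2], intro conjI Un_least)
      show "?z \<subseteq> span (?x \<union> (\<lambda>j. column j X) ` B)"
        by (auto simp: colZ intro!: span_diff intro: span_base span_mono[THEN subsetD, OF _ yJ])
      have "y j + (column j X - y j) \<in> span (?x \<union> ?z)" if "j \<in> B" for j
        using that by (intro span_add span_mono[THEN subsetD, OF _ yJ] span_base) (auto simp: colZ)
      then show "(\<lambda>j. column j X) ` B \<subseteq> span (?x \<union> ?z)" by auto
    qed (auto intro: span_base)
    then have "col_rank X (J \<union> B) = dim (?x \<union> ?z)"
      unfolding col_rank_eq_dim image_Un by (metis dim_span)
    moreover have "span ?x \<inter> span ?z = {0}"
    proof -
      have "?z \<subseteq> S''" using y(2) \<open>B \<subseteq> I k\<close> by (auto simp: colZ)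
      then have "span ?z \<subseteq> S''" using sub(2) by (simp add: span_minimal)
      then have "span ?x \<inter> span ?z \<subseteq> S' \<inter> orthogonal_comp S'"
        unfolding S''_def S'_def col_span_def by blast
      then have "span ?x \<inter> span ?z \<subseteq> {0}"
        using orthogonal_Int_0[OF sub(1)] by blast
      then show ?thesis using span_0 by blast
    qed
    ultimately show ?thesis
      using dim_Un_Int_span[of ?x ?z] by (simp add: col_rank_eq_dim)
  qed
  have "col_rank Z A = card A \<or> col_rank Z A = col_rank Z (I k)"
    using nd
  proof
    assume z: "\<forall>j\<in>I k. column j Z = 0"
    have "col_rank Z B = 0" if "B \<subseteq> I k" for B
      using z that unfolding col_rank_eq_dim by (subst dim_eq_0) blast
    then show ?thesis using assms(3) by simp
  qed (use nondegenerate_rank assms(3) in blast)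
  then show ?thesis
  proof
    assume "col_rank Z A = col_rank Z (I k)"
    then have "col_rank X (J \<union> I k) \<le> col_rank X (J \<union> A)"
      using rank[of A] rank[of "I k"] assms(3) by simp
    moreover have "col_span X (J \<union> A) \<subseteq> col_span X (J \<union> I k)"
      using assms(3) by (intro col_span_mono) blast
    ultimately have "col_span X (J \<union> A) = col_span X (J \<union> I k)"
      by (intro col_span_eqI)
    then show ?thesis using col_span_mono[of "I k" "J \<union> I k" X] by blast
  qed (use rank[OF assms(3)] in simp)
qed

text \<open>Add the segments of \<open>B\<close> one at a time. By submodularity,
  \<open>B \<inter> I m\<close> raises the rank of the earlier part of \<open>B\<close> at least as
  much as that of \<open>B - I m\<close>, hence by its full cardinality.\<close>

lemma col_rank_eq_card_if_independent_segments:
  fixes I :: "nat \<Rightarrow> 'n::finite set"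
  assumes "disjoint_family_on I {..<K}" and "B \<subseteq> (\<Union>k<K. I k)"
    and "\<And>k. k < K \<Longrightarrow> col_rank X B = col_rank X (B - I k) + card (B \<inter> I k)"
  shows "col_rank X B = card B"
proof -
  have "card (B \<inter> (\<Union>k<m. I k)) \<le> col_rank X (B \<inter> (\<Union>k<m. I k))" if "m \<le> K" for m
    using that
  proof (induction m)
    case (Suc m)
    let ?P = "B \<inter> (\<Union>k<m. I k)" and ?Q = "B \<inter> I m"
    have disj: "?P \<inter> I m = {}"
    proof -
      have "I k \<inter> I m = {}" if "k < m" for k
        using assms(1) Suc.prems that by (intro disjoint_family_onD) auto
      then show ?thesis by blast
    qed
    have eq: "B \<inter> (\<Union>k<Suc m. I k) = ?P \<union> ?Q"
      by (auto simp: less_Suc_eq)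
    have "(?P \<union> ?Q) \<union> (B - I m) = B" "(?P \<union> ?Q) \<inter> (B - I m) = ?P"
      using disj by auto
    then have "col_rank X B + col_rank X ?P \<le> col_rank X (?P \<union> ?Q) + col_rank X (B - I m)"
      using col_rank_submodular[of X "?P \<union> ?Q" "B - I m"] by simp
    moreover have "card (?P \<union> ?Q) = card ?P + card ?Q"
      using disj by (intro card_Un_disjoint) auto
    ultimately show ?case
      using Suc assms(3)[of m] unfolding eq by simp
  qed simp
  from this[of K] show ?thesis
    using assms(2) col_rank_le_card[of B X] by (simp add: Int_absorb2)
qed

section \<open>Rank bounds for unions of segments\<close>

locale MSS_setting =
  fixes X :: "real^'n::finite^'m" and K :: nat and I :: "nat \<Rightarrow> 'n set"
  assumes MSS: "is_MSS X K I"
    and not_shared: "\<forall>j. \<forall>k<K. \<forall>l<K. k \<noteq> l \<longrightarrow> column j X \<notin> col_span X (I k) \<inter> col_span X (I l)"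
    and intersected: "intersected_nondegenerately X K I"
    and d_int_less: "d_int X K I < d_min X K I"
    and d_0_le: "d_0 X K I \<le> d_min X K I"
    and card_gt: "\<forall>k<K. card (I k) > col_rank X (I k) + (K - 1) * d_0 X K I"
begin

lemma cover: "(\<Union>k<K. I k) = UNIV"
  and disjoint: "disjoint_family_on I {..<K}"
  and minimal: "k < K \<Longrightarrow> minimal_span X (I k)"
  using MSS by (auto simp: is_MSS_def)

lemma d_min_le: "k < K \<Longrightarrow> d_min X K I \<le> col_rank X (I k)"
  unfolding d_min_def by (intro Min_le) auto

lemma dim_Int_le_d_int:
  assumes "k < K" "j < K" "k \<noteq> j"
  shows "dim (col_span X (I k) \<inter> col_span X (I j)) \<le> d_int X K I"
  unfolding d_int_def
proof (rule Max_ge)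
  have "{dim (col_span X (I k) \<inter> col_span X (I j)) |k j. k < K \<and> j < K \<and> k \<noteq> j} \<subseteq>
      (\<lambda>(k, j). dim (col_span X (I k) \<inter> col_span X (I j))) ` ({..<K} \<times> {..<K})"
    by auto
  then show "finite (insert 0 {dim (col_span X (I k) \<inter> col_span X (I j)) |k j. k < K \<and> j < K \<and> k \<noteq> j})"
    by (meson finite_SigmaI finite_imageI finite_insert finite_lessThan finite_subset)
qed (use assms in blast)

lemma dim_Int_le_d_0:
  assumes "k < K" and "T \<subseteq> {..<K} - {k}"
  shows "dim (col_span X (I k) \<inter> col_span X (\<Union>j\<in>T. I j)) \<le> d_0 X K I"
proof -
  have "col_span X (\<Union>j\<in>T. I j) \<subseteq> col_span X (\<Union>j\<in>{..<K} - {k}. I j)"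
    using assms(2) by (intro col_span_mono) blast
  then have "dim (col_span X (I k) \<inter> col_span X (\<Union>j\<in>T. I j))
      \<le> dim (col_span X (I k) \<inter> col_span X (\<Union>j\<in>{..<K} - {k}. I j))"
    by (intro dim_subset) blast
  also have "\<dots> = dim (col_span X (I k) \<inter> (\<Sum>j\<in>{..<K} - {k}. col_span X (I j)))"
    by (simp add: sum_col_span)
  also have "\<dots> \<le> d_0 X K I"
    unfolding d_0_def using assms(1) by (intro Max_ge) auto
  finally show ?thesis .
qed

text \<open>The segments of \<open>U\<close> join the union one by one, and each meets the span
  built so far in dimension at most \<open>d_0\<close>.\<close>

lemma rank_add_segments:
  assumes "finite U" and "T \<union> U \<subseteq> {..<K}" and "T \<inter> U = {}"
  shows "col_rank X (\<Union>j\<in>T. I j) + (\<Sum>k\<in>U. col_rank X (I k))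
    \<le> col_rank X (\<Union>j\<in>T \<union> U. I j) + card U * d_0 X K I"
  using assms
proof (induction U rule: finite_induct)
  case (insert k U)
  have "dim (col_span X (I k) \<inter> col_span X (\<Union>j\<in>T \<union> U. I j)) \<le> d_0 X K I"
    using insert.prems insert.hyps by (intro dim_Int_le_d_0) auto
  moreover have "(\<Union>j\<in>T \<union> insert k U. I j) = I k \<union> (\<Union>j\<in>T \<union> U. I j)"
    by blast
  ultimately show ?case
    using insert col_rank_Un[of X "I k" "\<Union>j\<in>T \<union> U. I j"] by simp
qed simp

lemma rank_extend_segments:
  assumes "T \<subseteq> V" and "V \<subseteq> {..<K}"
  shows "col_rank X (\<Union>j\<in>T. I j) + (\<Sum>k\<in>V - T. col_rank X (I k))
    \<le> col_rank X (\<Union>j\<in>V. I j) + card (V - T) * d_min X K I"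
proof -
  have "T \<union> (V - T) = V" using assms(1) by blast
  then have "col_rank X (\<Union>j\<in>T. I j) + (\<Sum>k\<in>V - T. col_rank X (I k))
    \<le> col_rank X (\<Union>j\<in>V. I j) + card (V - T) * d_0 X K I"
    using rank_add_segments[of "V - T" T] assms(2) by (metis Diff_disjoint finite_Diff finite_lessThan finite_subset)
  also have "\<dots> \<le> col_rank X (\<Union>j\<in>V. I j) + card (V - T) * d_min X K I"
    using d_0_le by simp
  finally show ?thesis .
qed

text \<open>Start from one segment and let every further one cost at most \<open>d_min\<close>. For
  strictness start from two, whose intersection costs at most \<open>d_int\<close>, less than
  \<open>d_min\<close>. The additive form avoids truncated subtraction.\<close>

lemma rank_segments_ge:
  assumes "T \<subseteq> {..<K}" and "T \<noteq> {}"
  shows "(\<Sum>k\<in>T. col_rank X (I k)) + d_min X K I \<le> col_rank X (\<Union>j\<in>T. I j) + card T * d_min X K I"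
    and "2 \<le> card T \<Longrightarrow>
      (\<Sum>k\<in>T. col_rank X (I k)) + d_min X K I < col_rank X (\<Union>j\<in>T. I j) + card T * d_min X K I"
proof -
  have fin: "finite T" using assms(1) finite_subset by blast
  obtain a where a: "a \<in> T" using assms(2) by blast
  have card: "card T = Suc (card (T - {a}))"
    using a fin by (metis card_Suc_Diff1)
  show "(\<Sum>k\<in>T. col_rank X (I k)) + d_min X K I \<le> col_rank X (\<Union>j\<in>T. I j) + card T * d_min X K I"
    using rank_extend_segments[of "{a}" T] a assms(1) sum.remove[OF fin a, of "\<lambda>k. col_rank X (I k)"]
    unfolding card by simp
  assume "2 \<le> card T"
  then have "T - {a} \<noteq> {}" using card by force
  then obtain b where b: "b \<in> T" "b \<noteq> a" by blast
  have card: "card T = Suc (Suc (card (T - {a, b})))"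
    using a b fin card card_Suc_Diff1[of "T - {a}" b] by (simp add: Diff_insert2[of T a "{b}"])
  have "a < K" "b < K" using assms(1) a b by auto
  then have "dim (col_span X (I a) \<inter> col_span X (I b)) < d_min X K I"
    using dim_Int_le_d_int[of a b] d_int_less b by simp
  moreover have "(\<Sum>k\<in>T. col_rank X (I k)) = col_rank X (I a) + col_rank X (I b) + (\<Sum>k\<in>T - {a,b}. col_rank X (I k))"
    using sum.subset_diff[of "{a,b}" T "\<lambda>k. col_rank X (I k)"] a b fin by simp
  ultimately show "(\<Sum>k\<in>T. col_rank X (I k)) + d_min X K I < col_rank X (\<Union>j\<in>T. I j) + card T * d_min X K I"
    using rank_extend_segments[of "{a, b}" T] a b assms(1) col_rank_Un[of X "I a" "I b"]
    unfolding card by simp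
qed

text \<open>Otherwise all \<open>card (I k)\<close> columns would count as new rank on top of the
  other \<open>K - 1\<close> segments, whose union falls short of the sum of their ranks by at most
  \<open>(K - 1) * d_0\<close>. The size condition \<open>card_gt\<close> outweighs this
  loss.\<close>

lemma segment_saturated:
  assumes "(\<Union>l<K. B l) = UNIV" and "disjoint_family_on B {..<K}"
    and "(\<Sum>l<K. col_rank X (B l)) \<le> (\<Sum>k<K. col_rank X (I k))" and "k < K"
  shows "\<exists>l<K. col_rank X (B l) \<noteq> col_rank X (B l - I k) + card (B l \<inter> I k)"
proof (rule ccontr)
  assume "\<not> ?thesis"
  then have "(\<Sum>l<K. col_rank X (B l)) = (\<Sum>l<K. col_rank X (B l - I k)) + (\<Sum>l<K. card (B l \<inter> I k))"
    unfolding sum.distrib[symmetric] by (intro sum.cong) auto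
  moreover have "(\<Sum>l<K. card (B l \<inter> I k)) = card (I k)"
  proof -
    have "card (\<Union>l<K. B l \<inter> I k) = (\<Sum>l<K. card (B l \<inter> I k))"
      using assms(2) by (intro card_UN_disjoint) (auto simp: disjoint_family_on_def)
    moreover have "(\<Union>l<K. B l \<inter> I k) = I k" using assms(1) by blast
    ultimately show ?thesis by simp
  qed
  moreover have "(\<Sum>j\<in>{..<K} - {k}. col_rank X (I j)) \<le> (\<Sum>l<K. col_rank X (B l - I k)) + (K - 1) * d_0 X K I"
  proof -
    have "(\<Sum>j\<in>{..<K} - {k}. col_rank X (I j)) \<le> col_rank X (\<Union>j\<in>{..<K} - {k}. I j) + (K - 1) * d_0 X K I"
      using rank_add_segments[of "{..<K} - {k}" "{}"] assms(4) by simp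
    also have "col_rank X (\<Union>j\<in>{..<K} - {k}. I j) \<le> col_rank X (\<Union>l\<in>{..<K}. B l - I k)"
    proof (rule col_rank_mono)
      show "(\<Union>j\<in>{..<K} - {k}. I j) \<subseteq> (\<Union>l\<in>{..<K}. B l - I k)"
      proof
        fix x assume "x \<in> (\<Union>j\<in>{..<K} - {k}. I j)"
        then obtain j where "j < K" "j \<noteq> k" "x \<in> I j" by blast
        then have "x \<notin> I k"
          using disjoint assms(4) by (auto simp: disjoint_family_on_def)
        moreover have "x \<in> (\<Union>l<K. B l)" using assms(1) by simp
        ultimately show "x \<in> (\<Union>l\<in>{..<K}. B l - I k)" by simp
      qed
    qed
    also have "\<dots> \<le> (\<Sum>l<K. col_rank X (B l - I k))"
      by (intro col_rank_UN_le) simp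
    finally show ?thesis by simp
  qed
  moreover have "(\<Sum>k<K. col_rank X (I k)) = col_rank X (I k) + (\<Sum>j\<in>{..<K} - {k}. col_rank X (I j))"
    using assms(4) by (intro sum.remove) auto
  ultimately show False
    using assms(3) card_gt[rule_format, OF assms(4)] by linarith
qed

end

section \<open>Recovering the segments from a partition of small total rank\<close>

lemma sum_UN_le_nat:
  fixes e :: "'a \<Rightarrow> nat"
  assumes "finite T" and "\<And>l. l \<in> T \<Longrightarrow> finite (F l)"
  shows "sum e (\<Union>l\<in>T. F l) \<le> (\<Sum>l\<in>T. sum e (F l))"
  using assms
proof (induction T rule: finite_induct)
  case (insert l T)
  then show ?case
    using sum_Un_nat[of "F l" "\<Union>l\<in>T. F l" e] by simp
qed simp

context MSS_setting
begin

text \<open>The matrix \<open>C\<close> will enter only through the bound \<open>rank_B\<close>, so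
  the identification of the blocks concerns nothing but column ranks of \<open>X\<close>.\<close>

lemma partition_eq_segments:
  assumes cover_B: "(\<Union>l<K. B l) = UNIV" and disjoint_B: "disjoint_family_on B {..<K}"
    and card_B: "\<And>l. l < K \<Longrightarrow> d_min X K I < card (B l)"
    and rank_B: "(\<Sum>l<K. col_rank X (B l)) \<le> (\<Sum>k<K. col_rank X (I k))"
  obtains \<sigma> where "bij_betw \<sigma> {..<K} {..<K}" and "\<And>l. l < K \<Longrightarrow> B l = I (\<sigma> l)"
proof -
  \<comment> \<open>\<open>F l\<close> collects the segments whose columns in \<open>B l\<close> are dependent modulo the rest of \<open>B l\<close>;
    nondegenerate intersection forces \<open>B l\<close> to span all of them.\<close>
  define F where "F l = {k. k < K \<and> col_rank X (B l) \<noteq> col_rank X (B l - I k) + card (B l \<inter> I k)}" for l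
  define m where "m = d_min X K I"
  \<comment> \<open>Excess of a segment over the least rank. The subtraction never truncates for
    \<open>k < K\<close>, as \<open>d_min\<close> is a lower bound.\<close>
  define e where "e k = col_rank X (I k) - m" for k
  have F_sub: "F l \<subseteq> {..<K}" and F_fin: "finite (F l)" for l
    by (auto simp: F_def)
  have F_cover: "{..<K} \<subseteq> (\<Union>l<K. F l)"
    using segment_saturated[OF cover_B disjoint_B rank_B] by (auto simp: F_def)
  have sat: "col_span X (I k) \<subseteq> col_span X (B l)" if "k \<in> F l" for k l
  proof -
    have "(B l - I k) \<union> (B l \<inter> I k) = B l" by blast
    moreover have "(B l - I k) \<inter> I k = {}" "B l \<inter> I k \<subseteq> I k" by blast+
    ultimately show ?thesis
      using intersected_nondegenerately_rank[OF intersected, of k "B l \<inter> I k" "B l - I k"] that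
      by (simp add: F_def)
  qed
  have sat_rank: "col_rank X (\<Union>k\<in>F l. I k) \<le> col_rank X (B l)" for l
  proof (rule col_rank_mono_span)
    have "column j X \<in> col_span X (B l)" if "j \<in> I k" "k \<in> F l" for j k
      using sat[OF that(2)] column_in_col_span[OF that(1), of X] by blast
    then show "col_span X (\<Union>k\<in>F l. I k) \<subseteq> col_span X (B l)"
      unfolding col_span_def[of X "\<Union>k\<in>F l. I k"]
      by (intro span_minimal) (auto simp: col_span_def)
  qed
  have e: "col_rank X (I k) = e k + m" if "k < K" for k
    using d_min_le[OF that] by (simp add: e_def m_def)
  have e_sum: "(\<Sum>k\<in>F l. col_rank X (I k)) = sum e (F l) + card (F l) * m" for l
  proof -
    have "(\<Sum>k\<in>F l. col_rank X (I k)) = (\<Sum>k\<in>F l. e k + m)"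
      using F_sub[of l] e by (intro sum.cong) auto
    then show ?thesis by (simp add: sum.distrib)
  qed
  \<comment> \<open>Without a saturated segment the columns of \<open>B l\<close> are independent,
    so its rank is its size, which exceeds \<open>m\<close>. With at least two, the strict bound for
    unions of segments applies.\<close>
  have strict: "sum e (F l) + m < col_rank X (B l)" if l: "l < K" and "card (F l) \<noteq> 1" for l
  proof (cases "F l = {}")
    case True
    then have "\<And>k. k < K \<Longrightarrow> col_rank X (B l) = col_rank X (B l - I k) + card (B l \<inter> I k)"
      by (auto simp: F_def)
    then have "col_rank X (B l) = card (B l)"
      by (intro col_rank_eq_card_if_independent_segments[OF disjoint]) (simp_all add: cover)
    then show ?thesis using card_B[OF l] True by (simp add: m_def)
  next
    case False
    then have "card (F l) \<noteq> 0" using F_fin by simp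
    then have "2 \<le> card (F l)" using that(2) by linarith
    from rank_segments_ge(2)[OF F_sub False this] show ?thesis
      using e_sum[of l] sat_rank[of l] unfolding m_def by linarith
  qed
  have lower: "sum e (F l) + m \<le> col_rank X (B l)" if l: "l < K" for l
  proof (cases "card (F l) = 1")
    case True
    then have "F l \<noteq> {}" by force
    from rank_segments_ge(1)[OF F_sub this] show ?thesis
      using e_sum[of l] sat_rank[of l] unfolding m_def by linarith
  qed (use strict[OF l] in simp)
  \<comment> \<open>After cancelling \<open>K\<close> copies of \<open>m\<close>, an exceptional
    block would leave the excesses summed over all \<open>F l\<close> strictly below the total
    excess of the segments, although the \<open>F l\<close> cover all segments.\<close>
  have F1: "card (F l) = 1" if l: "l < K" for l
  proof (rule ccontr)
    assume "card (F l) \<noteq> 1"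
    then have "(\<Sum>l<K. sum e (F l) + m) < (\<Sum>l<K. col_rank X (B l))"
      using l lower strict by (intro sum_strict_mono_ex1) auto
    also have "\<dots> \<le> (\<Sum>k<K. e k + m)"
      using rank_B e by simp
    finally have "(\<Sum>l<K. sum e (F l)) < sum e {..<K}"
      by (simp add: sum.distrib)
    also have "\<dots> \<le> sum e (\<Union>l<K. F l)"
      using F_cover F_fin by (intro sum_mono2) auto
    also have "\<dots> \<le> (\<Sum>l<K. sum e (F l))"
      using F_fin by (intro sum_UN_le_nat) auto
    finally show False by simp
  qed
  then have "\<forall>l\<in>{..<K}. \<exists>k. F l = {k}"
    by (auto simp: card_1_singleton_iff)
  then obtain \<sigma> where \<sigma>: "\<And>l. l < K \<Longrightarrow> F l = {\<sigma> l}"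
    by (metis lessThan_iff)
  \<comment> \<open>\<open>K\<close> singletons cover \<open>K\<close> segments, so
    \<open>\<sigma>\<close> is onto, hence injective by finiteness.\<close>
  have \<sigma>_img: "\<sigma> ` {..<K} = {..<K}"
    using F_cover F_sub \<sigma> by fastforce
  then have inj: "inj_on \<sigma> {..<K}"
    by (intro finite_surj_inj) auto
  have bij: "bij_betw \<sigma> {..<K} {..<K}"
    using inj \<sigma>_img by (simp add: bij_betw_def)
  have \<sigma>_lt: "\<sigma> l < K" if "l < K" for l
    using \<sigma>_img that by blast
  have sub: "col_span X (I (\<sigma> l)) \<subseteq> col_span X (B l)" if "l < K" for l
    using sat \<sigma>[OF that] by blast
  \<comment> \<open>Each block has at least the rank of its segment, so a single larger one would
    push the total above the sum of the segment ranks.\<close>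
  have rank_eq: "col_rank X (B l) \<le> col_rank X (I (\<sigma> l))" if l: "l < K" for l
  proof (rule ccontr)
    assume "\<not> ?thesis"
    then have "(\<Sum>l<K. col_rank X (I (\<sigma> l))) < (\<Sum>l<K. col_rank X (B l))"
      using l sub by (intro sum_strict_mono_ex1) (auto intro: col_rank_mono_span simp: not_le)
    also have "(\<Sum>l<K. col_rank X (I (\<sigma> l))) = (\<Sum>k<K. col_rank X (I k))"
      using sum.reindex_bij_betw[OF bij, of "\<lambda>k. col_rank X (I k)"] by simp
    finally show False using rank_B by simp
  qed
  \<comment> \<open>The spans agree, so each column of \<open>B l\<close> lies in the span of
    \<open>I (\<sigma> l)\<close>; \<open>not_shared\<close> excludes that it belongs to another
    segment.\<close>
  have B_sub: "B l \<subseteq> I (\<sigma> l)" if l: "l < K" for l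
  proof
    fix j assume j: "j \<in> B l"
    have "col_span X (I (\<sigma> l)) = col_span X (B l)"
      using sub[OF l] rank_eq[OF l] by (rule col_span_eqI)
    then have jl: "column j X \<in> col_span X (I (\<sigma> l))"
      using column_in_col_span[OF j] by simp
    obtain k where k: "k < K" "j \<in> I k" using cover by blast
    then have "k = \<sigma> l"
      using not_shared \<sigma>_lt[OF l] jl column_in_col_span[OF k(2), of X] by blast
    then show "j \<in> I (\<sigma> l)" using k by simp
  qed
  have "B l = I (\<sigma> l)" if l: "l < K" for l
  proof
    show "I (\<sigma> l) \<subseteq> B l"
    proof
      fix j assume j: "j \<in> I (\<sigma> l)"
      obtain l' where l': "l' < K" "j \<in> B l'" using cover_B by blast
      then have "j \<in> I (\<sigma> l')" using B_sub by blast
      then have "\<sigma> l' = \<sigma> l"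
        using disjoint_family_onD[OF disjoint, of "\<sigma> l'" "\<sigma> l"] \<sigma>_lt l l'(1) j by auto
      then have "l' = l" using inj l l'(1) by (auto dest: inj_onD)
      then show "j \<in> B l" using l' by simp
    qed
  qed (rule B_sub[OF l])
  with bij show ?thesis by (rule that)
qed

end

section \<open>Column ranks of products and of block matrices\<close>

lemma column_matrix_mult: "column j (A ** C) = A *v column j C"
  by (simp add: vec_eq_iff column_def matrix_matrix_mult_def matrix_vector_mult_def)

text \<open>For a representation, \<open>X = X ** C\<close> makes this a lower bound on the ranks of
  column sets of \<open>C\<close>.\<close>

lemma col_rank_matrix_mult_le:
  fixes A :: "real^'n::finite^'m" and C :: "real^'k^'n"
  shows "col_rank (A ** C) J \<le> col_rank C J"
proof -
  have "(\<lambda>j. column j (A ** C)) ` J = (*v) A ` (\<lambda>j. column j C) ` J"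
    by (simp add: column_matrix_mult image_image)
  then show ?thesis
    unfolding col_rank_eq_dim by (simp add: dim_image_le)
qed

lemma rank_eq_col_rank: "rank C = col_rank C UNIV"
  by (simp add: column_rank_def columns_def col_rank_eq_dim full_SetCompr_eq)

lemma supported_span:
  fixes S :: "(real^'n::finite) set"
  assumes "\<And>x i. x \<in> S \<Longrightarrow> i \<notin> A \<Longrightarrow> x $ i = 0" and "x \<in> span S" and "i \<notin> A"
  shows "x $ i = 0"
proof -
  have "subspace {x :: real^'n. x $ i = 0}"
    by (simp add: subspace_def)
  then have "span S \<subseteq> {x. x $ i = 0}"
    using assms(1,3) by (intro span_minimal) auto
  then show ?thesis using assms(2) by blast
qed

lemma dim_Un_disjoint_support:
  fixes S T :: "(real^'n::finite) set"
  assumes "\<And>x i. x \<in> S \<Longrightarrow> i \<notin> A \<Longrightarrow> x $ i = 0" and "\<And>x i. x \<in> T \<Longrightarrow> i \<notin> B \<Longrightarrow> x $ i = 0"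
    and "A \<inter> B = {}"
  shows "dim (S \<union> T) = dim S + dim T"
proof -
  have "x = 0" if "x \<in> span S" "x \<in> span T" for x
  proof -
    have "x $ i = 0" for i
      using supported_span[of S A x i, OF assms(1) that(1)] supported_span[of T B x i, OF assms(2) that(2)] assms(3)
      by blast
    then show ?thesis by (simp add: vec_eq_iff)
  qed
  then have "span S \<inter> span T \<subseteq> {0}" by blast
  then have "dim (span S \<inter> span T) = 0" by (subst dim_eq_0)
  then show ?thesis using dim_Un_Int_span[of S T] by linarith
qed

text \<open>Columns from different blocks live on disjoint sets of rows, so their spans form a
  direct sum.\<close>

lemma col_rank_UN_blocks:
  fixes C :: "real^'k^'n::finite"
  assumes "finite T" and "disjoint_family_on A T"
    and "\<And>l i j. l \<in> T \<Longrightarrow> j \<in> B l \<Longrightarrow> i \<notin> A l \<Longrightarrow> C $ i $ j = 0"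
  shows "col_rank C (\<Union>l\<in>T. B l) = (\<Sum>l\<in>T. col_rank C (B l))"
  using assms
proof (induction T rule: finite_induct)
  case (insert l T)
  have "A l \<inter> (\<Union>l\<in>T. A l) = {}"
    using insert.prems(1) insert.hyps by (auto simp: disjoint_family_on_def)
  moreover have "C $ i $ j = 0" if "k \<in> T" "j \<in> B k" "i \<notin> A k" for i j k
    using insert.prems(2)[OF insertI2] that by blast
  ultimately have "col_rank C (B l \<union> (\<Union>l\<in>T. B l)) = col_rank C (B l) + col_rank C (\<Union>l\<in>T. B l)"
    unfolding col_rank_eq_dim image_Un
    by (intro dim_Un_disjoint_support[where A = "A l" and B = "\<Union>l\<in>T. A l"])
      (auto simp: column_def intro: insert.prems(2))
  moreover have "col_rank C (\<Union>l\<in>T. B l) = (\<Sum>l\<in>T. col_rank C (B l))"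
  proof (rule insert.IH)
    show "disjoint_family_on A T"
      using insert.prems(1) by (auto simp: disjoint_family_on_def)
  qed (use insert.prems(2) in blast)
  ultimately show ?case using insert.hyps by simp
qed simp

text \<open>A nonzero kernel vector \<open>x\<close> extends to a basis of \<open>span S\<close>.
  The image of \<open>S\<close> would then be spanned by the images of the other basis vectors,
  which are fewer than \<open>dim S\<close>.\<close>

lemma linear_kernel_trivial_if_dim_preserved:
  fixes f :: "'a::euclidean_space \<Rightarrow> 'b::euclidean_space"
  assumes "linear f" and "dim (f ` S) = dim S" and "x \<in> span S" and "f x = 0"
  shows "x = 0"
proof (rule ccontr)
  assume "x \<noteq> 0"
  then have "independent {x}" by simp
  moreover have "{x} \<subseteq> span S" using assms(3) by simp
  ultimately obtain B where B: "{x} \<subseteq> B" "B \<subseteq> span S" "independent B" "span S \<subseteq> span B"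
    using maximal_independent_subset_extend by metis
  have fin: "finite B" using B(3) by (rule independent_imp_finite)
  have "card B = dim S"
    using B by (metis dim_eq_card_independent dim_span span_eq span_span subset_antisym)
  have "f ` B \<subseteq> insert 0 (f ` (B - {x}))"
    using assms(4) by blast
  then have "f ` B \<subseteq> span (f ` (B - {x}))"
    by (meson insert_subset span_0 span_superset subset_trans)
  moreover have "f ` S \<subseteq> span (f ` B)"
    using B(4) span_superset[of S] linear_span_image[OF assms(1), of B] by blast
  ultimately have "f ` S \<subseteq> span (f ` (B - {x}))"
    by (meson span_minimal subset_trans subspace_span)
  then have "dim (f ` S) \<le> card (f ` (B - {x}))"
    using fin by (intro dim_le_card) auto
  also have "\<dots> \<le> card (B - {x})"
    using fin by (intro card_image_le) auto
  also have "\<dots> < card B"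
    using fin B(1) by (intro psubset_card_mono) auto
  finally show False
    using assms(2) \<open>card B = dim S\<close> by simp
qed

section \<open>Permutations and block-diagonal form\<close>

lemma perm_conj_nth:
  fixes D :: "real^'n^'n"
  assumes "p permutes UNIV"
  shows "(perm_matrix p ** D ** transpose (perm_matrix p)) $ p i $ p j = D $ i $ j"
proof -
  have "p a = p b \<longleftrightarrow> a = b" for a b
    using permutes_inj[OF assms] by (simp add: inj_eq)
  then show ?thesis
    by (simp add: matrix_matrix_mult_def transpose_def perm_matrix_def if_distrib[of "\<lambda>x. x * _"]
        if_distrib[of "\<lambda>x. _ * x"] cong: if_cong)
qed

text \<open>\<open>block_diagonal\<close> demands consecutive blocks, so an arbitrary block
  numbering \<open>f\<close> has to be sorted first.\<close>

lemma ex_sorting_permutation: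
  fixes f :: "'n::{finite,linorder} \<Rightarrow> nat"
  obtains p where "p permutes UNIV" and "mono (f \<circ> p)"
proof -
  define xs where "xs = sorted_list_of_set (UNIV :: 'n set)"
  define ys where "ys = sort_key f xs"
  define N where "N = CARD('n)"
  have len: "length xs = N" "length ys = N"
    by (simp_all add: xs_def ys_def N_def)
  have bx: "bij_betw ((!) xs) {..<N} UNIV"
    by (intro bij_betw_nth) (simp_all add: len, simp_all add: xs_def)
  have yx: "bij_betw ((!) ys) {..<N} UNIV"
    by (intro bij_betw_nth) (simp_all add: len, simp_all add: xs_def ys_def)
  \<comment> \<open>Position of an index in the increasing list \<open>xs\<close>; \<open>p\<close>
    sends the index to the entry of \<open>ys\<close> at that position.\<close>
  define g where "g = inv_into {..<N} ((!) xs)"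
  have bg: "bij_betw g UNIV {..<N}"
    unfolding g_def by (rule bij_betw_inv_into[OF bx])
  have g: "g i < N" "xs ! g i = i" for i
    using bg bx unfolding g_def bij_betw_def by (auto simp: f_inv_into_f)
  define p where "p = (\<lambda>i. ys ! g i)"
  have "bij p"
    using bij_betw_trans[OF bg yx] by (simp add: p_def comp_def)
  then have "p permutes UNIV"
    by (rule bij_imp_permutes) simp
  moreover have "mono (f \<circ> p)"
  proof (rule monoI)
    fix i j :: 'n assume "i \<le> j"
    have "g i \<le> g j"
    proof (rule ccontr)
      assume "\<not> g i \<le> g j"
      then have "xs ! g j \<le> xs ! g i"
        using g(1)[of i] len by (intro sorted_nth_mono) (auto simp: xs_def)
      then have "i = j" using \<open>i \<le> j\<close> g(2) by simp
      then show False using \<open>\<not> g i \<le> g j\<close> by simp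
    qed
    then have "map f ys ! g i \<le> map f ys ! g j"
      using g(1)[of j] len by (intro sorted_nth_mono) (auto simp: ys_def)
    then show "(f \<circ> p) i \<le> (f \<circ> p) j"
      using g(1) len by (simp add: p_def)
  qed
  ultimately show ?thesis by (rule that)
qed

lemma block_diagonal_up_to_permI:
  fixes C :: "real^('n::{finite,linorder})^('n::{finite,linorder})"
  assumes "\<And>j. f j < K" and "\<And>k. k < K \<Longrightarrow> s < card {j. f j = k}"
    and "\<And>i j. f i \<noteq> f j \<Longrightarrow> C $ i $ j = 0"
  shows "block_diagonal_up_to_perm K s C"
proof -
  obtain p where p: "p permutes UNIV" and mono: "mono (f \<circ> p)"
    by (rule ex_sorting_permutation)
  have inj: "inj p" and surj: "surj p"
    by (rule permutes_inj[OF p], rule permutes_surj[OF p])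
  have blocks: "{j. (f \<circ> p) j = k} = p -` {j. f j = k}" for k
    by auto
  have card: "card {j. (f \<circ> p) j = k} = card {j. f j = k}" for k
    unfolding blocks using inj surj by (intro card_vimage_inj) auto
  define D where "D = (\<chi> i j. C $ p i $ p j)"
  have "C = perm_matrix p ** D ** transpose (perm_matrix p)"
  proof -
    have "C $ p i $ p j = (perm_matrix p ** D ** transpose (perm_matrix p)) $ p i $ p j" for i j
      using perm_conj_nth[OF p] by (simp add: D_def)
    then show ?thesis
      unfolding vec_eq_iff using surj by (metis surjD)
  qed
  moreover have "block_diagonal K (f \<circ> p) D"
    unfolding block_diagonal_def
  proof (intro conjI mono allI impI)
    have "k \<in> range (f \<circ> p)" if "k < K" for k
    proof -
      have "card {j. (f \<circ> p) j = k} \<noteq> 0"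
        using assms(2)[OF that] unfolding card by linarith
      then have "{j. (f \<circ> p) j = k} \<noteq> {}" by force
      then show ?thesis by blast
    qed
    then show "range (f \<circ> p) = {..<K}" using assms(1) by auto
  qed (use assms(3) in \<open>simp add: D_def\<close>)
  moreover have "\<forall>k<K. s < card {j. (f \<circ> p) j = k}"
    using assms(2) unfolding card by simp
  ultimately show ?thesis
    unfolding block_diagonal_up_to_perm_def using p by blast
qed

text \<open>Transports the blocks of \<open>D\<close> to the original column numbering, where the
  rank count takes place.\<close>

lemma block_diagonal_perm_blocks:
  assumes "p permutes UNIV" and "block_diagonal K b D"
    and C: "C = perm_matrix p ** D ** transpose (perm_matrix p)"
  shows "(\<Union>l<K. p ` {j. b j = l}) = UNIV" and "disjoint_family_on (\<lambda>l. p ` {j. b j = l}) {..<K}"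
    and "card (p ` {j. b j = l}) = card {j. b j = l}"
    and "j \<in> p ` {j. b j = l} \<Longrightarrow> i \<notin> p ` {j. b j = l} \<Longrightarrow> C $ i $ j = 0"
proof -
  have inj: "inj p" and surj: "surj p"
    by (rule permutes_inj[OF assms(1)], rule permutes_surj[OF assms(1)])
  have b: "range b = {..<K}" and D: "\<And>i j. b i \<noteq> b j \<Longrightarrow> D $ i $ j = 0"
    using assms(2) by (auto simp: block_diagonal_def)
  have "x \<in> (\<Union>l<K. p ` {j. b j = l})" for x
  proof -
    obtain y where "x = p y" using surj by (metis surjD)
    moreover have "b y < K" using b by blast
    ultimately show ?thesis by blast
  qed
  then show "(\<Union>l<K. p ` {j. b j = l}) = UNIV" by blast
  show "disjoint_family_on (\<lambda>l. p ` {j. b j = l}) {..<K}"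
    using inj by (auto simp: disjoint_family_on_def dest: injD)
  show "card (p ` {j. b j = l}) = card {j. b j = l}"
    using inj by (intro card_image) (auto intro: inj_on_subset)
  assume j: "j \<in> p ` {j. b j = l}" and i: "i \<notin> p ` {j. b j = l}"
  obtain j' where "j = p j'" "b j' = l" using j by blast
  moreover obtain i' where "i = p i'" using surj by (metis surjD)
  ultimately show "C $ i $ j = 0"
    using i D[of i' j'] unfolding C by (auto simp: perm_conj_nth[OF assms(1)])
qed

section \<open>Connectedness of the blocks\<close>

text \<open>If \<open>U\<close> were proper, the two parts of \<open>C\<close> would occupy disjoint
  rows, so their ranks would add up to that of \<open>L\<close>, and the corresponding ranks in
  \<open>X\<close> to at most \<open>col_rank X L\<close>. Both are positive, hence both are smaller
  than \<open>col_rank X L\<close>. Nondegeneracy then makes both parts independent, so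
  \<open>card L \<le> col_rank X L\<close>, against minimality.\<close>

lemma minimal_block_indecomposable:
  fixes X :: "real^'n::finite^'m" and C :: "real^'n^'n"
  assumes rep: "is_representation X C" and min: "minimal_span X L" and "0 < col_rank X L"
    and rank: "col_rank C L = col_rank X L"
    and supp: "\<And>i j. j \<in> L \<Longrightarrow> i \<notin> L \<Longrightarrow> C $ i $ j = 0"
    and U: "U \<subseteq> L" "U \<noteq> {}"
    and sep: "\<And>i j. i \<in> U \<Longrightarrow> j \<in> L - U \<Longrightarrow> C $ i $ j = 0 \<and> C $ j $ i = 0"
  shows "U = L"
proof (rule ccontr)
  assume "U \<noteq> L"
  let ?V = "L - U"
  have "?V \<noteq> {}" using \<open>U \<noteq> L\<close> U(1) by blast
  have le: "col_rank X S \<le> col_rank C S" for S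
    using rep col_rank_matrix_mult_le[of X C S] by (simp add: is_representation_def)
  have UV: "U \<union> ?V = L" using U(1) by blast
  have "col_rank C (U \<union> ?V) = col_rank C U + col_rank C ?V"
    unfolding col_rank_eq_dim image_Un
  proof (rule dim_Un_disjoint_support[where A = U and B = ?V])
    show "x $ i = 0" if "x \<in> (\<lambda>j. column j C) ` U" "i \<notin> U" for x i
      using that U(1) supp sep by (cases "i \<in> L") (auto simp: column_def)
    show "x $ i = 0" if "x \<in> (\<lambda>j. column j C) ` ?V" "i \<notin> ?V" for x i
      using that U(1) supp sep by (cases "i \<in> L") (auto simp: column_def)
  qed blast
  then have sum: "col_rank X U + col_rank X ?V \<le> col_rank X L"
    using le[of U] le[of ?V] rank UV by simp
  have card: "card U + card ?V = card L"
    using U(1) by (metis UV card_Un_disjoint Diff_disjoint finite)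
  have nd: "nondegenerate X L" and gt: "col_rank X L < card L"
    using min by (auto simp: minimal_span_def)
  have full: "col_rank X S = card S" if "S \<subseteq> L" "col_rank X S < col_rank X L" for S
    using nd that by (auto simp: nondegenerate_def)
  have pos: "0 < col_rank X S" if "S \<subseteq> L" "S \<noteq> {}" for S
    using full[OF that(1)] that(2) assms(3) by (cases "col_rank X S < col_rank X L") (auto simp: card_gt_0_iff)
  have "col_rank X U < col_rank X L" "col_rank X ?V < col_rank X L"
    using sum pos[of U] pos[of ?V] U \<open>?V \<noteq> {}\<close> by auto
  then have "col_rank X U = card U" "col_rank X ?V = card ?V"
    using full U(1) by auto
  then show False using sum card gt by simp
qed

section \<open>Representation matrices of the required rank\<close>

context MSS_setting
begin

lemma rank_pos: "k < K \<Longrightarrow> 0 < col_rank X (I k)"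
  using d_min_le[of k] d_int_less by linarith

text \<open>Ranks in \<open>X\<close> are bounded by ranks in \<open>C\<close>, so the blocks obey
  the bound of \<open>partition_eq_segments\<close>. Once they are known to be segments, both totals
  agree, which forces equality block by block.\<close>

lemma representation_blocks:
  assumes rep: "is_representation X C" and rank: "rank C = (\<Sum>k<K. col_rank X (I k))"
    and B: "(\<Union>l<K. B l) = UNIV" "disjoint_family_on B {..<K}" "\<And>l. l < K \<Longrightarrow> d_min X K I < card (B l)"
    and supp: "\<And>l i j. l < K \<Longrightarrow> j \<in> B l \<Longrightarrow> i \<notin> B l \<Longrightarrow> C $ i $ j = 0"
  obtains \<sigma> where "bij_betw \<sigma> {..<K} {..<K}" and "\<And>l. l < K \<Longrightarrow> B l = I (\<sigma> l)"
    and "\<And>l. l < K \<Longrightarrow> col_rank C (B l) = col_rank X (B l)"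
proof -
  have le: "col_rank X S \<le> col_rank C S" for S
    using rep col_rank_matrix_mult_le[of X C S] by (simp add: is_representation_def)
  have "rank C = col_rank C (\<Union>l<K. B l)"
    by (simp add: rank_eq_col_rank B(1))
  also have "\<dots> = (\<Sum>l<K. col_rank C (B l))"
    using B(2) supp by (intro col_rank_UN_blocks[where A = B]) auto
  finally have sum_C: "(\<Sum>l<K. col_rank C (B l)) = (\<Sum>k<K. col_rank X (I k))"
    using rank by simp
  moreover have "(\<Sum>l<K. col_rank X (B l)) \<le> (\<Sum>l<K. col_rank C (B l))"
    by (intro sum_mono le)
  ultimately obtain \<sigma> where \<sigma>: "bij_betw \<sigma> {..<K} {..<K}" "\<And>l. l < K \<Longrightarrow> B l = I (\<sigma> l)"
    using partition_eq_segments[OF B] by metis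
  have "(\<Sum>l<K. col_rank X (B l)) = (\<Sum>k<K. col_rank X (I k))"
    using sum.reindex_bij_betw[OF \<sigma>(1), of "\<lambda>k. col_rank X (I k)"] \<sigma>(2) by simp
  then have "col_rank X (B l) = col_rank C (B l)" if "l < K" for l
    using sum_mono_inv[of "\<lambda>l. col_rank X (B l)" "{..<K}" "\<lambda>l. col_rank C (B l)" l] sum_C le that by simp
  then show ?thesis using that[of \<sigma>] \<sigma> by metis
qed

text \<open>\<open>X\<close> is injective on the column space of each diagonal block, since it preserves its dimension.\<close>

lemma representation_mult:
  assumes rep: "is_representation X C" "is_representation X C'"
    and supp: "\<And>k i j. k < K \<Longrightarrow> j \<in> I k \<Longrightarrow> i \<notin> I k \<Longrightarrow> C' $ i $ j = 0"
    and rank: "\<And>k. k < K \<Longrightarrow> col_rank C (I k) = col_rank X (I k)"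
  shows "C ** C' = C"
proof -
  have "column j (C ** C') = column j C" for j
  proof -
    obtain k where k: "k < K" "j \<in> I k" using cover by blast
    let ?S = "(\<lambda>j. column j C) ` I k"
    have X: "X *v column i C = column i X" "X *v column i C' = column i X" for i
      using rep by (metis column_matrix_mult is_representation_def)+
    have "C *v column j C' = (\<Sum>i\<in>UNIV. (column j C' $ i) *s column i C)"
      by (rule matrix_mult_sum)
    also have "\<dots> \<in> span ?S"
    proof (rule span_sum)
      fix i
      show "(column j C' $ i) *s column i C \<in> span ?S"
      proof (cases "i \<in> I k")
        case True
        then show ?thesis by (simp add: span_base span_scale scalar_mult_eq_scaleR)
      next
        case False
        then show ?thesis using supp[OF k] by (simp add: column_def span_0)
      qed
    qed
    finally have "C *v column j C' - column j C \<in> span ?S"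
      using k by (intro span_diff) (auto intro: span_base)
    \<comment> \<open>Both representations fix \<open>X\<close>, so \<open>X\<close> maps either
      vector to its own column \<open>j\<close>.\<close>
    moreover have "X *v (C *v column j C' - column j C) = 0"
    proof -
      have "X *v (C *v column j C') = X *v column j C'"
        using rep(1) by (simp add: matrix_vector_mul_assoc is_representation_def)
      then show ?thesis by (simp add: matrix_vector_mult_diff_distrib X)
    qed
    moreover have "dim ((*v) X ` ?S) = dim ?S"
      using rank[OF k(1)] by (simp add: image_image X col_rank_eq_dim)
    ultimately have "C *v column j C' - column j C = 0"
      by (intro linear_kernel_trivial_if_dim_preserved[of "(*v) X" ?S]) auto
    then show ?thesis by (simp add: column_matrix_mult)
  qed
  then show ?thesis by (simp add: vec_eq_iff column_def)
qed

text \<open>Transposing \<open>C ** C' = C\<close> gives \<open>C' ** C = C\<close>, while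
  exchanging the roles gives \<open>C' ** C = C'\<close>.\<close>

lemma symmetric_representation_unique:
  assumes "is_representation X C" "is_representation X C'"
    and "\<And>k i j. k < K \<Longrightarrow> j \<in> I k \<Longrightarrow> i \<notin> I k \<Longrightarrow> C $ i $ j = 0"
    and "\<And>k i j. k < K \<Longrightarrow> j \<in> I k \<Longrightarrow> i \<notin> I k \<Longrightarrow> C' $ i $ j = 0"
    and "\<And>k. k < K \<Longrightarrow> col_rank C (I k) = col_rank X (I k)"
    and "\<And>k. k < K \<Longrightarrow> col_rank C' (I k) = col_rank X (I k)"
    and "transpose C = C" "transpose C' = C'"
  shows "C = C'"
proof -
  have "C ** C' = C" "C' ** C = C'"
    using assms by (auto intro!: representation_mult)
  then show ?thesis
    using assms(7,8) by (metis matrix_transpose_mul)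
qed

end

section \<open>Existence of a symmetric solution\<close>

lemma orthogonal_projection_matrix:
  fixes S :: "(real^'n::finite) set"
  assumes "subspace S"
  obtains P :: "real^'n^'n" where "transpose P = P" and "\<And>x. x \<in> S \<Longrightarrow> P *v x = x" and "\<And>j. column j P \<in> S"
proof -
  obtain B where B: "B \<subseteq> S" "pairwise orthogonal B" "\<And>b. b \<in> B \<Longrightarrow> norm b = 1"
      "independent B" "span B = S"
    by (rule orthonormal_basis_subspace[OF assms]) blast
  have fin: "finite B" using B(4) by (rule independent_imp_finite)
  \<comment> \<open>Sum of the rank-one projections onto the vectors of an orthonormal basis of
    \<open>S\<close>.\<close>
  define P :: "real^'n^'n" where "P = (\<chi> i j. \<Sum>b\<in>B. b $ i * b $ j)"
  have "transpose P = P"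
    by (simp add: P_def transpose_def vec_eq_iff mult.commute)
  moreover have "P *v x = x" if "x \<in> S" for x
  proof -
    have "P *v x = (\<Sum>b\<in>B. (x \<bullet> b) *\<^sub>R b)"
    proof (rule vec_eq_iff[THEN iffD2], intro allI)
      fix i
      have "(P *v x) $ i = (\<Sum>j\<in>UNIV. \<Sum>b\<in>B. b $ i * b $ j * x $ j)"
        by (simp add: P_def matrix_vector_mult_def sum_distrib_right)
      also have "\<dots> = (\<Sum>b\<in>B. \<Sum>j\<in>UNIV. b $ i * b $ j * x $ j)"
        by (rule sum.swap)
      also have "\<dots> = (\<Sum>b\<in>B. (x \<bullet> b) *\<^sub>R b) $ i"
        by (simp add: inner_vec_def sum_distrib_left mult_ac)
      finally show "(P *v x) $ i = (\<Sum>b\<in>B. (x \<bullet> b) *\<^sub>R b) $ i" .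
    qed
    also have "\<dots> = x"
      using B(2,3,5) fin that by (intro orthonormal_basis_expand) auto
    finally show ?thesis .
  qed
  moreover have "column j P \<in> S" for j
  proof -
    have "column j P = (\<Sum>b\<in>B. b $ j *\<^sub>R b)"
      by (simp add: column_def P_def vec_eq_iff mult.commute)
    then show ?thesis
      using B(1) assms by (auto intro!: subspace_sum subspace_scale)
  qed
  ultimately show ?thesis by (rule that)
qed

context MSS_setting
begin

text \<open>Each diagonal block is the orthogonal projection onto the row space of the segment.\<close>

lemma symmetric_representation_exists:
  obtains C where "is_representation X C" and "transpose C = C"
    and "\<And>k i j. k < K \<Longrightarrow> j \<in> I k \<Longrightarrow> i \<notin> I k \<Longrightarrow> C $ i $ j = 0"
    and "rank C = (\<Sum>k<K. col_rank X (I k))"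
proof -
  \<comment> \<open>Zeroing the other columns makes the rows vectors supported on
    \<open>I k\<close>, so projections of different segments act on disjoint coordinates.\<close>
  define Y :: "nat \<Rightarrow> real^'n^'m" where "Y k = (\<chi> i j. if j \<in> I k then X $ i $ j else 0)" for k
  have "\<exists>P. transpose P = P \<and> (\<forall>x \<in> span (rows (Y k)). P *v x = x) \<and> (\<forall>j. column j P \<in> span (rows (Y k)))" for k
    using orthogonal_projection_matrix[of "span (rows (Y k))"] by (metis subspace_span)
  then obtain P where P: "\<And>k. transpose (P k) = P k"
      "\<And>k x. x \<in> span (rows (Y k)) \<Longrightarrow> P k *v x = x" "\<And>k j. column j (P k) \<in> span (rows (Y k))"
    by metis
  have P_sym: "P k $ i $ j = P k $ j $ i" for k i j
    using arg_cong[OF P(1)[of k], of "\<lambda>M. M $ j $ i"] by (simp add: transpose_def)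
  have P0: "P k $ i $ j = 0" if "i \<notin> I k" for k i j
  proof -
    have "column j (P k) $ i = 0"
    proof (rule supported_span[OF _ P(3) that])
      show "x $ a = 0" if "x \<in> rows (Y k)" "a \<notin> I k" for x a
        using that by (auto simp: rows_def row_def Y_def)
    qed
    then show ?thesis by (simp add: column_def)
  qed
  have "\<exists>k. k < K \<and> j \<in> I k" for j
    using UNIV_I[of j] unfolding cover[symmetric] by blast
  then obtain f where f: "\<And>j. f j < K" "\<And>j. j \<in> I (f j)" by metis
  have f_eq: "f j = k" if "k < K" "j \<in> I k" for j k
    using disjoint_family_onD[OF disjoint, of k "f j"] f[of j] that by auto
  \<comment> \<open>Column \<open>j\<close> comes from the projection of its own segment, and
    \<open>P0\<close> clears the entries outside it; the result is the sum of the \<open>P k\<close>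
    over \<open>k < K\<close>.\<close>
  define C where "C = (\<chi> i j. P (f j) $ i $ j)"
  have col: "column j C = column j (P k)" if "k < K" "j \<in> I k" for j k
    using f_eq[OF that] by (simp add: C_def column_def)
  have supp: "C $ i $ j = 0" if "k < K" "j \<in> I k" "i \<notin> I k" for k i j
    using f_eq[OF that(1,2)] P0[OF that(3)] by (simp add: C_def)
  have sym: "transpose C = C"
  proof -
    have "C $ j $ i = C $ i $ j" for i j
    proof (cases "f i = f j")
      case True
      then have "C $ j $ i = P (f j) $ j $ i" by (simp add: C_def)
      also have "\<dots> = P (f j) $ i $ j" by (rule P_sym)
      finally show ?thesis by (simp add: C_def)
    next
      case False
      have "i \<notin> I (f j)"
        using False f_eq[of "f j" i, OF f(1)] by blast
      moreover have "j \<notin> I (f i)"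
        using False f_eq[of "f i" j, OF f(1)] by metis
      ultimately have "P (f j) $ i $ j = 0" "P (f i) $ j $ i = 0"
        using P0 by blast+
      then show ?thesis by (simp add: C_def)
    qed
    then show ?thesis by (simp add: transpose_def vec_eq_iff)
  qed
  have rep: "is_representation X C"
  proof -
    have "(X ** C) $ i $ j = X $ i $ j" for i j
    proof -
      let ?k = "f j"
      have "(X ** C) $ i $ j = (\<Sum>a\<in>UNIV. X $ i $ a * P ?k $ a $ j)"
        by (simp add: matrix_matrix_mult_def C_def)
      \<comment> \<open>Symmetry of \<open>P ?k\<close> turns right multiplication into its action
        on row \<open>i\<close> of \<open>Y ?k\<close>, which it fixes.\<close>
      also have "\<dots> = (\<Sum>a\<in>UNIV. P ?k $ j $ a * row i (Y ?k) $ a)"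
        using P0 P_sym[of ?k j] by (intro sum.cong) (auto simp: row_def Y_def)
      also have "\<dots> = (P ?k *v row i (Y ?k)) $ j"
        by (simp add: matrix_vector_mult_def)
      also have "P ?k *v row i (Y ?k) = row i (Y ?k)"
        by (intro P(2) span_base) (auto simp: rows_def)
      also have "row i (Y ?k) $ j = X $ i $ j"
        using f(2) by (simp add: row_def Y_def)
      finally show ?thesis .
    qed
    then show ?thesis by (simp add: is_representation_def vec_eq_iff)
  qed
  have "col_rank C (I k) = col_rank X (I k)" if k: "k < K" for k
  proof (rule antisym)
    have "(\<lambda>j. column j C) ` I k \<subseteq> span (rows (Y k))"
      using col[OF k] P(3) by auto
    then have "col_rank C (I k) \<le> dim (rows (Y k))"
      unfolding col_rank_eq_dim by (metis dim_span dim_subset)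
    also have "\<dots> = dim (columns (Y k))"
      using row_rank_def[of "Y k"] column_rank_def[of "Y k"] by simp
    \<comment> \<open>The extra 0 accounts for the zeroed columns of \<open>Y k\<close>.\<close>
    also have "\<dots> \<le> dim (insert 0 ((\<lambda>j. column j X) ` I k))"
    proof (rule dim_subset, rule subsetI)
      fix y assume "y \<in> columns (Y k)"
      then obtain j where "y = column j (Y k)" by (auto simp: columns_def)
      then show "y \<in> insert 0 ((\<lambda>j. column j X) ` I k)"
        by (cases "j \<in> I k") (auto simp: column_def Y_def vec_eq_iff image_iff)
    qed
    also have "\<dots> = col_rank X (I k)"
      by (simp add: col_rank_eq_dim dim_insert span_0)
    finally show "col_rank C (I k) \<le> col_rank X (I k)" .
    show "col_rank X (I k) \<le> col_rank C (I k)"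
      using rep col_rank_matrix_mult_le[of X C "I k"] by (simp add: is_representation_def)
  qed
  then have "rank C = (\<Sum>k<K. col_rank X (I k))"
    using col_rank_UN_blocks[of "{..<K}" I I C] disjoint supp by (simp add: rank_eq_col_rank cover)
  with rep sym supp show ?thesis by (rule that)
qed

lemma d_min_less_card: "k < K \<Longrightarrow> d_min X K I < card (I k)"
  using d_min_le[of k] card_gt[rule_format, of k] by linarith

end

section \<open>Detectability and uniqueness combined\<close>

lemma is_MSS_reindex:
  assumes "is_MSS X K I" and "bij_betw \<sigma> {..<K} {..<K}"
    and "\<And>l. l < K \<Longrightarrow> B l = I (\<sigma> l)" and "(\<Union>l<K. B l) = UNIV" and "disjoint_family_on B {..<K}"
  shows "is_MSS X K B"
proof -
  have \<sigma>: "\<sigma> l < K" if "l < K" for l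
    using assms(2) that by (auto simp: bij_betw_def)
  have inj: "\<sigma> l = \<sigma> l' \<longleftrightarrow> l = l'" if "l < K" "l' < K" for l l'
    using assms(2) that by (auto simp: bij_betw_def dest: inj_onD)
  show ?thesis
    using assms(1,3,4,5) \<sigma> inj by (simp add: is_MSS_def)
qed

text \<open>The uniqueness claim takes the form \<open>\<exists>!\<close>, so it also asserts that a
  symmetric solution exists.\<close>

theorem theorem10:
  fixes X :: "real^('n::{finite,linorder})^'m"
    and K :: nat and I :: "nat \<Rightarrow> 'n set"
  assumes "is_MSS X K I"
    and "\<forall>j. \<forall>k<K. \<forall>l<K. k \<noteq> l \<longrightarrow> column j X \<notin> col_span X (I k) \<inter> col_span X (I l)"
    and "intersected_nondegenerately X K I"
    and "d_int X K I < d_min X K I"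
    and "d_0 X K I \<le> d_min X K I"
    and "\<forall>k<K. card (I k) > col_rank X (I k) + (K - 1) * d_0 X K I"
  shows "(\<forall>C. is_representation X C \<and> block_diagonal_up_to_perm K (d_min X K I) C \<and>
              rank C = (\<Sum>k<K. col_rank X (I k))
            \<longrightarrow> is_MSDR X C) \<and>
         (\<exists>!C. is_representation X C \<and> block_diagonal_up_to_perm K (d_min X K I) C \<and>
              rank C = (\<Sum>k<K. col_rank X (I k)) \<and> transpose C = C)"
proof -
  interpret MSS_setting X K I
    by (rule MSS_setting.intro[OF assms])
  \<comment> \<open>The permutation \<open>p\<close> hidden in the hypothesis on \<open>C\<close>
    numbers the blocks in its own order; \<open>\<sigma>\<close> matches them with the
    segments.\<close>
  have blocks: "\<exists>p b D \<sigma>. p permutes UNIV \<and> block_diagonal K b D \<and>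
      C = perm_matrix p ** D ** transpose (perm_matrix p) \<and> bij_betw \<sigma> {..<K} {..<K} \<and>
      (\<forall>l<K. p ` {j. b j = l} = I (\<sigma> l)) \<and> (\<forall>l<K. col_rank C (I (\<sigma> l)) = col_rank X (I (\<sigma> l)))"
    if C: "is_representation X C" "block_diagonal_up_to_perm K (d_min X K I) C"
      "rank C = (\<Sum>k<K. col_rank X (I k))" for C
  proof -
    obtain p b D where pbD: "p permutes UNIV" "block_diagonal K b D"
        "C = perm_matrix p ** D ** transpose (perm_matrix p)"
        and card: "\<forall>k<K. d_min X K I < card {j. b j = k}"
      using C(2) unfolding block_diagonal_up_to_perm_def by blast
    note B = block_diagonal_perm_blocks[OF pbD]
    have "\<exists>\<sigma>. bij_betw \<sigma> {..<K} {..<K} \<and> (\<forall>l<K. p ` {j. b j = l} = I (\<sigma> l)) \<and>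
        (\<forall>l<K. col_rank C (p ` {j. b j = l}) = col_rank X (p ` {j. b j = l}))"
    proof (rule representation_blocks[OF C(1,3) B(1,2)])
      show "d_min X K I < card (p ` {j. b j = l})" if "l < K" for l
        using card that B(3) by simp
      show "C $ i $ j = 0" if "j \<in> p ` {j. b j = l}" "i \<notin> p ` {j. b j = l}" for l i j
        using that by (rule B(4))
    qed blast
    then obtain \<sigma> where "bij_betw \<sigma> {..<K} {..<K}" "\<And>l. l < K \<Longrightarrow> p ` {j. b j = l} = I (\<sigma> l)"
        "\<And>l. l < K \<Longrightarrow> col_rank C (p ` {j. b j = l}) = col_rank X (p ` {j. b j = l})"
      by blast
    then show ?thesis using pbD by (intro exI[of _ p] exI[of _ b] exI[of _ D] exI[of _ \<sigma>]) auto
  qed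
  \<comment> \<open>The same information freed of \<open>p\<close> and \<open>\<sigma>\<close>, so
    that two solutions with different permutations can be compared.\<close>
  have supp: "(\<forall>k<K. \<forall>j\<in>I k. \<forall>i. i \<notin> I k \<longrightarrow> C $ i $ j = 0) \<and> (\<forall>k<K. col_rank C (I k) = col_rank X (I k))"
    if C: "is_representation X C" "block_diagonal_up_to_perm K (d_min X K I) C"
      "rank C = (\<Sum>k<K. col_rank X (I k))" for C
  proof -
    obtain p b D \<sigma> where pbD: "p permutes UNIV" "block_diagonal K b D"
        "C = perm_matrix p ** D ** transpose (perm_matrix p)"
      and \<sigma>: "bij_betw \<sigma> {..<K} {..<K}" "\<And>l. l < K \<Longrightarrow> p ` {j. b j = l} = I (\<sigma> l)"
        "\<And>l. l < K \<Longrightarrow> col_rank C (I (\<sigma> l)) = col_rank X (I (\<sigma> l))"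
      using blocks[OF C] by blast
    have "(\<forall>j\<in>I k. \<forall>i. i \<notin> I k \<longrightarrow> C $ i $ j = 0) \<and> col_rank C (I k) = col_rank X (I k)" if "k < K" for k
    proof -
      obtain l where l: "l < K" "k = \<sigma> l" using \<sigma>(1) \<open>k < K\<close> by (auto simp: bij_betw_def)
      then have "I k = p ` {j. b j = l}" using \<sigma>(2) by simp
      then show ?thesis
        using block_diagonal_perm_blocks(4)[OF pbD, of _ l] \<sigma>(3)[OF l(1)] l(2) by metis
    qed
    then show ?thesis by blast
  qed
  have MSDR: "is_MSDR X C"
    if C: "is_representation X C" "block_diagonal_up_to_perm K (d_min X K I) C"
      "rank C = (\<Sum>k<K. col_rank X (I k))" for C
  proof -
    obtain p b D \<sigma> where pbD: "p permutes UNIV" "block_diagonal K b D"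
        "C = perm_matrix p ** D ** transpose (perm_matrix p)"
      and \<sigma>: "bij_betw \<sigma> {..<K} {..<K}" "\<And>l. l < K \<Longrightarrow> p ` {j. b j = l} = I (\<sigma> l)"
        "\<And>l. l < K \<Longrightarrow> col_rank C (I (\<sigma> l)) = col_rank X (I (\<sigma> l))"
      using blocks[OF C] by blast
    note B = block_diagonal_perm_blocks[OF pbD]
    have "is_MSS X K (\<lambda>l. p ` {j. b j = l})"
      using is_MSS_reindex[OF MSS \<sigma>(1,2) B(1,2)] .
    moreover have "connected_matrix D {j. b j = l}" if l: "l < K" for l
      unfolding connected_matrix_def
    proof (intro ballI)
      let ?S = "{j. b j = l}"
      let ?R = "{(u, v). u \<in> ?S \<and> v \<in> ?S \<and> \<bar>D $ u $ v\<bar> + \<bar>D $ v $ u\<bar> \<noteq> 0}"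
      fix i j assume i: "i \<in> ?S" and j: "j \<in> ?S"
      \<comment> \<open>The component of \<open>i\<close> in the graph of the block. No edge leaves
        it, so its image under \<open>p\<close> is separated from the rest of the segment and must
        fill it.\<close>
      define V where "V = {v \<in> ?S. (i, v) \<in> ?R\<^sup>*}"
      have inj: "inj p" using pbD(1) by (rule permutes_inj)
      have k: "\<sigma> l < K" using \<sigma>(1) l by (auto simp: bij_betw_def)
      have "p ` V = I (\<sigma> l)"
      proof (rule minimal_block_indecomposable[OF C(1) minimal[OF k] rank_pos[OF k] \<sigma>(3)[OF l]])
        show "C $ a $ c = 0" if "c \<in> I (\<sigma> l)" "a \<notin> I (\<sigma> l)" for a c
          using supp[OF C] k that by blast
        show "p ` V \<subseteq> I (\<sigma> l)"
          unfolding \<sigma>(2)[OF l, symmetric] V_def by blast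
        show "p ` V \<noteq> {}" using i by (auto simp: V_def)
        fix a c assume "a \<in> p ` V" "c \<in> I (\<sigma> l) - p ` V"
        then obtain u v where uv: "a = p u" "c = p v" "u \<in> V" "v \<in> ?S" "v \<notin> V"
          unfolding \<sigma>(2)[OF l, symmetric] by blast
        have "(u, v) \<notin> ?R"
          using uv rtrancl_into_rtrancl[of i u ?R v] unfolding V_def by blast
        then have "\<bar>D $ u $ v\<bar> + \<bar>D $ v $ u\<bar> = 0"
          using uv by (auto simp: V_def)
        then show "C $ a $ c = 0 \<and> C $ c $ a = 0"
          unfolding pbD(3) uv perm_conj_nth[OF pbD(1)] by linarith
      qed
      then have "p j \<in> p ` V" using j \<sigma>(2)[OF l] by blast
      then have "j \<in> V" using inj by (simp add: inj_image_mem_iff)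
      then show "(i, j) \<in> ?R\<^sup>*" by (simp add: V_def)
    qed
    ultimately show ?thesis
      unfolding is_MSDR_def using C(1) pbD by blast
  qed
  have unique: "\<exists>!C. is_representation X C \<and> block_diagonal_up_to_perm K (d_min X K I) C \<and>
      rank C = (\<Sum>k<K. col_rank X (I k)) \<and> transpose C = C"
  proof (rule ex_ex1I)
    obtain C where C: "is_representation X C" "transpose C = C"
        "\<And>k i j. k < K \<Longrightarrow> j \<in> I k \<Longrightarrow> i \<notin> I k \<Longrightarrow> C $ i $ j = 0"
        "rank C = (\<Sum>k<K. col_rank X (I k))"
      using symmetric_representation_exists by blast
    have "\<exists>k. k < K \<and> j \<in> I k" for j
      using UNIV_I[of j] unfolding cover[symmetric] by blast
    then obtain f where f: "\<And>j. f j < K" "\<And>j. j \<in> I (f j)" by metis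
    have f_iff: "f j = k \<longleftrightarrow> j \<in> I k" if "k < K" for j k
      using disjoint_family_onD[OF disjoint, of k "f j"] f[of j] that by auto
    \<comment> \<open>The number of the segment containing an index serves as its block
      number.\<close>
    have "block_diagonal_up_to_perm K (d_min X K I) C"
    proof (rule block_diagonal_up_to_permI[of f])
      show "C $ i $ j = 0" if "f i \<noteq> f j" for i j
        using C(3)[OF f(1) f(2)] f_iff[OF f(1)] that by blast
    qed (use f f_iff d_min_less_card in auto)
    then show "\<exists>C. is_representation X C \<and> block_diagonal_up_to_perm K (d_min X K I) C \<and>
        rank C = (\<Sum>k<K. col_rank X (I k)) \<and> transpose C = C"
      using C by blast
  next
    fix C C'
    assume C: "is_representation X C \<and> block_diagonal_up_to_perm K (d_min X K I) C \<and>
        rank C = (\<Sum>k<K. col_rank X (I k)) \<and> transpose C = C"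
      and C': "is_representation X C' \<and> block_diagonal_up_to_perm K (d_min X K I) C' \<and>
        rank C' = (\<Sum>k<K. col_rank X (I k)) \<and> transpose C' = C'"
    note S = supp[of C, OF C[THEN conjunct1] C[THEN conjunct2, THEN conjunct1]
        C[THEN conjunct2, THEN conjunct2, THEN conjunct1]]
    note S' = supp[of C', OF C'[THEN conjunct1] C'[THEN conjunct2, THEN conjunct1]
        C'[THEN conjunct2, THEN conjunct2, THEN conjunct1]]
    show "C = C'"
    proof (rule symmetric_representation_unique)
      show "C $ i $ j = 0" if "k < K" "j \<in> I k" "i \<notin> I k" for k i j
        using S that by blast
      show "C' $ i $ j = 0" if "k < K" "j \<in> I k" "i \<notin> I k" for k i j
        using S' that by blast
    qed (use C C' S S' in simp_all)
  qed
  show ?thesis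
  proof (intro conjI allI impI unique)
    fix C
    assume "is_representation X C \<and> block_diagonal_up_to_perm K (d_min X K I) C \<and>
        rank C = (\<Sum>k<K. col_rank X (I k))"
    then show "is_MSDR X C" by (elim conjE) (rule MSDR)
  qed
qed

end
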